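(* Let $S$ be a nearly abelian semigroup of non-injective entire maps, with commutator set $K(S)$. Let $G(S)$ be the group generated by $K(S)$ and let $T(S)=\langle G(S),S\rangle$ be the semigroup generated by $S$ and $G(S)$. Then $S$ is right amenable whenever one of the following conditions holds: \begin{enumerate} \item The commutator set $K(S)$ is finite. \item The semigroup $T(S)$ is cancellative and $S$ contains no free non-cyclic subsemigroups. \end{enumerate}
   Context: $\mathrm{Aff}(\mathbb{C})$ is the group of affine maps $z\mapsto az+b$, $a\neq0$. A semigroup $S$ of non-constant entire maps (under composition) is called nearly abelian if for every pair $f,g\in S$ there exists $\gamma\in\mathrm{Aff}(\mathbb{C})$ such that $f\circ g=\gamma\circ g\circ f$. The collection $K(S)\subset\mathrm{Aff}(\mathbb{C})$ of all such $\gamma$, over all pairs $f,g\in S$, is the commutator set of $S$. A semigroup is cancellative if $ca=cb$ implies $a=b$ and $ac=bc$ implies $a=b$. "Free non-cyclic" means free on at least two generators. A semigroup $T$ is right amenable if there is a finitely additive probability measure $\mu$ defined on all subsets of $T$ with $\mu(r_\gamma^{-1}(A))=\mu(A)$ for all $A\subset T$, $\gamma\in T$, where $r_\gamma(g)=g\gamma$. *)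

theory Defs
  imports "HOL-Complex_Analysis.Complex_Analysis" "HOL-Algebra.Generated_Groups"
begin

definition Aff :: "(complex \<Rightarrow> complex) monoid" where
  "Aff = \<lparr>carrier = {\<gamma>. \<exists>a b. a \<noteq> 0 \<and> \<gamma> = (\<lambda>z. a * z + b)}, mult = (\<circ>), one = id\<rparr>"

lemma group_Aff: "group Aff"
proof (rule groupI)
  fix x y assume "x \<in> carrier Aff" "y \<in> carrier Aff"
  then obtain a b c d where h: "a \<noteq> 0" "x = (\<lambda>z. a * z + b)" "c \<noteq> 0" "y = (\<lambda>z. c * z + d)"
    unfolding Aff_def by auto
  then have "x \<circ> y = (\<lambda>z. (a * c) * z + (a * d + b))" "a * c \<noteq> 0"
    by (auto simp: algebra_simps)
  then have "\<exists>p q. p \<noteq> 0 \<and> x \<circ> y = (\<lambda>z. p * z + q)"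
    by blast
  then show "x \<otimes>\<^bsub>Aff\<^esub> y \<in> carrier Aff"
    unfolding Aff_def by simp
next
  show "\<one>\<^bsub>Aff\<^esub> \<in> carrier Aff"
  proof -
    have "(1::complex) \<noteq> 0 \<and> id = (\<lambda>z::complex. 1 * z + 0)"
      by (simp add: id_def)
    then have "\<exists>a b. (a::complex) \<noteq> 0 \<and> id = (\<lambda>z. a * z + b)"
      by blast
    then show ?thesis
      unfolding Aff_def by simp
  qed
next
  fix x assume "x \<in> carrier Aff"
  then obtain a b where h: "a \<noteq> 0" "x = (\<lambda>z. a * z + b)"
    unfolding Aff_def by auto
  let ?y = "\<lambda>z. inverse a * z + (- b / a)"
  have "?y \<in> carrier Aff"
  proof -
    have "inverse a \<noteq> 0"
      using h(1) by simp
    then have "\<exists>p q. p \<noteq> 0 \<and> ?y = (\<lambda>z. p * z + q)"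
      by blast
    then show ?thesis
      unfolding Aff_def by simp
  qed
  moreover have "?y \<circ> x = id"
    using h by (auto simp: fun_eq_iff field_simps)
  ultimately show "\<exists>y\<in>carrier Aff. y \<otimes>\<^bsub>Aff\<^esub> x = \<one>\<^bsub>Aff\<^esub>"
    unfolding Aff_def by (intro bexI[of _ ?y]) simp_all
qed (auto simp: Aff_def comp_assoc)

definition comp_closed :: "('a \<Rightarrow> 'a) set \<Rightarrow> bool" where
  "comp_closed S \<longleftrightarrow> (\<forall>f\<in>S. \<forall>g\<in>S. f \<circ> g \<in> S)"

text \<open>Semigroups are non-empty: the empty set carries no probability measure.\<close>

definition comp_semigroup :: "('a \<Rightarrow> 'a) set \<Rightarrow> bool" where
  "comp_semigroup S \<longleftrightarrow> S \<noteq> {} \<and> comp_closed S"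

definition nearly_abelian :: "(complex \<Rightarrow> complex) set \<Rightarrow> bool" where
  "nearly_abelian S \<longleftrightarrow>
     comp_semigroup S \<and>
     (\<forall>f\<in>S. f holomorphic_on UNIV \<and> \<not> f constant_on UNIV) \<and>
     (\<forall>f\<in>S. \<forall>g\<in>S. \<exists>\<gamma>\<in>carrier Aff. f \<circ> g = \<gamma> \<circ> g \<circ> f)"

definition commutator_set :: "(complex \<Rightarrow> complex) set \<Rightarrow> (complex \<Rightarrow> complex) set" where
  "commutator_set S = {\<gamma> \<in> carrier Aff. \<exists>f\<in>S. \<exists>g\<in>S. f \<circ> g = \<gamma> \<circ> g \<circ> f}"

definition commutator_group :: "(complex \<Rightarrow> complex) set \<Rightarrow> (complex \<Rightarrow> complex) set" where
  "commutator_group S = generate Aff (commutator_set S)"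

definition extended_semigroup :: "(complex \<Rightarrow> complex) set \<Rightarrow> (complex \<Rightarrow> complex) set" where
  "extended_semigroup S = comp_closed hull (commutator_group S \<union> S)"

definition cancellative :: "('a \<Rightarrow> 'a) set \<Rightarrow> bool" where
  "cancellative T \<longleftrightarrow>
     (\<forall>a\<in>T. \<forall>b\<in>T. \<forall>c\<in>T. (c \<circ> a = c \<circ> b \<longrightarrow> a = b) \<and> (a \<circ> c = b \<circ> c \<longrightarrow> a = b))"

text \<open>\<open>F\<close> is the free semigroup with basis \<open>X\<close>: it is generated by \<open>X\<close>, and distinct non-empty
  words over \<open>X\<close> have distinct values.\<close>

definition free_semigroup_on :: "('a \<Rightarrow> 'a) set \<Rightarrow> ('a \<Rightarrow> 'a) set \<Rightarrow> bool" where
  "free_semigroup_on X F \<longleftrightarrow>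
     F = comp_closed hull X \<and> inj_on (\<lambda>w. foldr (\<circ>) w id) {w \<in> lists X. w \<noteq> []}"

definition free_noncyclic :: "('a \<Rightarrow> 'a) set \<Rightarrow> bool" where
  "free_noncyclic F \<longleftrightarrow> (\<exists>X. free_semigroup_on X F \<and> (\<exists>x\<in>X. \<exists>y\<in>X. x \<noteq> y))"

definition right_amenable :: "('a \<Rightarrow> 'a) set \<Rightarrow> bool" where
  "right_amenable T \<longleftrightarrow>
     (\<exists>\<mu> :: ('a \<Rightarrow> 'a) set \<Rightarrow> real.
        (\<forall>A\<in>Pow T. 0 \<le> \<mu> A) \<and> additive (Pow T) \<mu> \<and> \<mu> T = 1 \<and>
        (\<forall>\<gamma>\<in>T. \<forall>A\<in>Pow T. \<mu> ((\<lambda>g. g \<circ> \<gamma>) -` A \<inter> T) = \<mu> A))"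

end

theory Submission
  imports Defs
begin

text \<open>
  Each of the two alternatives implies the left Ore condition: any \<open>f\<close> and \<open>g\<close> in \<open>S\<close> have a common
  left multiple \<open>a \<circ> f = b \<circ> g\<close>. If \<open>K(S)\<close> is finite, two of the commutators of \<open>f\<close> with the powers of
  \<open>g\<close> are equal, and comparing these powers produces the multiple
  (\<open>left_Ore_if_finite_commutator_set\<close>). If \<open>S\<close> has no free non-cyclic subsemigroup, some two distinct
  words in \<open>f \<noteq> g\<close> have the same value. Composition with a non-constant entire map can be cancelled on the
  right, so a common suffix of the words can be removed; what remains is a common left multiple,
  because no element of \<open>S\<close> is injective and hence none is the identity
  (\<open>left_Ore_if_no_free_subsemigroup\<close>).

  The left Ore condition in turn yields amenability. A computation with commutators gives
  \<open>f G(S) \<subseteq> G(S) f\<close> for \<open>f \<in> S\<close> (\<open>push_commutator_group\<close>). Consider the chain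
  \<open>{id} \<subseteq> V \<subseteq> G(S) \<subseteq> W\<close>, where \<open>V\<close> consists of the translations in \<open>G(S)\<close> and \<open>W\<close> (\<open>group_translates\<close>) of all \<open>\<gamma>\<close> and
  \<open>\<gamma> \<circ> f\<close> with \<open>\<gamma> \<in> G(S)\<close>, \<open>f \<in> S\<close>. In each step the larger monoid commutes up to left multiplication by
  the smaller one, so \<open>W\<close> is amenable like a solvable group of length three.

  A mean on \<open>W\<close> need not charge \<open>S\<close>, so the passage from \<open>W\<close> to \<open>S\<close> is made with finite
  approximations. Amenability is expressed by finite averages that are almost invariant under
  finitely many right multiplications (\<open>right_Folner\<close>). This property climbs the chain by adjoining
  one generator at a time (\<open>right_Folner_abelian_extension\<close>). By the Ore condition every
  element of \<open>G(S)\<close> is a left fraction of elements of \<open>S\<close>, and finitely many elements of \<open>W\<close>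
  have a common denominator \<open>s\<close>. Left multiplication by \<open>s\<close> therefore carries a finite
  average into \<open>S\<close>, and it commutes with all right multiplications. Finally, compactness of a
  Tychonoff cube turns almost invariant averages on \<open>S\<close> into an invariant finitely additive
  probability (\<open>right_amenable_if_right_Folner\<close>).
\<close>

section \<open>Almost invariant averages\<close>

text \<open>A list stands for the uniform average over its entries, counted with multiplicity. Testing
  against all functions bounded by one makes the bound on \<open>ps\<close> uniform over all sets.\<close>

definition almost_invariant :: "('a \<Rightarrow> 'a) list \<Rightarrow> real \<Rightarrow> ('a \<Rightarrow> 'a) \<Rightarrow> bool" where
  "almost_invariant ps e d \<longleftrightarrow>
     (\<forall>h :: ('a \<Rightarrow> 'a) \<Rightarrow> real. (\<forall>x. \<bar>h x\<bar> \<le> 1) \<longrightarrow>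
        \<bar>(\<Sum>p\<leftarrow>ps. h (p \<circ> d)) - (\<Sum>p\<leftarrow>ps. h p)\<bar> \<le> e * length ps)"

definition right_Folner :: "('a \<Rightarrow> 'a) set \<Rightarrow> bool" where
  "right_Folner N \<longleftrightarrow>
     (\<forall>D e. finite D \<longrightarrow> D \<subseteq> N \<longrightarrow> 0 < e \<longrightarrow>
        (\<exists>ps. ps \<noteq> [] \<and> set ps \<subseteq> N \<and> (\<forall>d\<in>D. almost_invariant ps e d)))"

lemma right_FolnerD:
  assumes "right_Folner N" "finite D" "D \<subseteq> N" "0 < e"
  obtains ps where "ps \<noteq> []" "set ps \<subseteq> N" "\<And>d. d \<in> D \<Longrightarrow> almost_invariant ps e d"
  using assms unfolding right_Folner_def by meson

lemma almost_invariantD: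
  assumes "almost_invariant ps e d" "\<And>x. \<bar>h x\<bar> \<le> 1"
  shows "\<bar>(\<Sum>p\<leftarrow>ps. h (p \<circ> d)) - (\<Sum>p\<leftarrow>ps. h p)\<bar> \<le> e * length ps"
  using assms unfolding almost_invariant_def by blast

lemma almost_invariant_mono:
  assumes "almost_invariant ps e d" "e \<le> e'"
  shows "almost_invariant ps e' d"
  unfolding almost_invariant_def
proof (intro allI impI)
  fix h :: "('a \<Rightarrow> 'a) \<Rightarrow> real" assume "\<forall>x. \<bar>h x\<bar> \<le> 1"
  then have "\<bar>(\<Sum>p\<leftarrow>ps. h (p \<circ> d)) - (\<Sum>p\<leftarrow>ps. h p)\<bar> \<le> e * length ps"
    using almost_invariantD[OF assms(1)] by blast
  also have "\<dots> \<le> e' * length ps"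
    using assms(2) by (simp add: mult_right_mono)
  finally show "\<bar>(\<Sum>p\<leftarrow>ps. h (p \<circ> d)) - (\<Sum>p\<leftarrow>ps. h p)\<bar> \<le> e' * length ps" .
qed

lemma almost_invariant_comp:
  assumes "almost_invariant ps e d" "almost_invariant ps e' d'"
  shows "almost_invariant ps (e + e') (d \<circ> d')"
  unfolding almost_invariant_def
proof (intro allI impI)
  fix h :: "('a \<Rightarrow> 'a) \<Rightarrow> real" assume h: "\<forall>x. \<bar>h x\<bar> \<le> 1"
  have "\<bar>(\<Sum>p\<leftarrow>ps. h (p \<circ> d \<circ> d')) - (\<Sum>p\<leftarrow>ps. h (p \<circ> d'))\<bar> \<le> e * length ps"
    using almost_invariantD[OF assms(1), of "\<lambda>x. h (x \<circ> d')"] h by simp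
  moreover have "\<bar>(\<Sum>p\<leftarrow>ps. h (p \<circ> d')) - (\<Sum>p\<leftarrow>ps. h p)\<bar> \<le> e' * length ps"
    using almost_invariantD[OF assms(2)] h by blast
  ultimately show "\<bar>(\<Sum>p\<leftarrow>ps. h (p \<circ> (d \<circ> d'))) - (\<Sum>p\<leftarrow>ps. h p)\<bar> \<le> (e + e') * length ps"
    by (simp add: comp_assoc algebra_simps)
qed

lemma almost_invariant_funpow:
  assumes "almost_invariant ps e f"
  shows "almost_invariant ps (real n * e) (f ^^ n)"
proof (induction n)
  case 0
  show ?case by (simp add: almost_invariant_def o_def)
next
  case (Suc n)
  from almost_invariant_comp[OF assms Suc] show ?case
    by (simp add: algebra_simps o_def)
qed

text \<open>Left and right multiplications commute, so moving the whole family from the left keeps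
  it almost invariant.\<close>

lemma almost_invariant_map_comp:
  assumes "almost_invariant ps e d"
  shows "almost_invariant (map ((\<circ>) s) ps) e d"
  unfolding almost_invariant_def
proof (intro allI impI)
  fix h :: "('a \<Rightarrow> 'a) \<Rightarrow> real" assume "\<forall>x. \<bar>h x\<bar> \<le> 1"
  then show "\<bar>(\<Sum>p\<leftarrow>map ((\<circ>) s) ps. h (p \<circ> d)) - (\<Sum>p\<leftarrow>map ((\<circ>) s) ps. h p)\<bar>
      \<le> e * length (map ((\<circ>) s) ps)"
    using almost_invariantD[OF assms, of "\<lambda>x. h (s \<circ> x)"] by (simp add: o_def)
qed

lemma sum_list_concat_blocks:
  fixes R :: nat and h :: "('a \<Rightarrow> 'a) \<Rightarrow> real"
  shows "(\<Sum>q\<leftarrow>concat (map (\<lambda>n. map (\<lambda>p. p \<circ> f ^^ n) ps) [0..<R]). h q) =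
    (\<Sum>n<R. \<Sum>p\<leftarrow>ps. h (p \<circ> f ^^ n))"
  by (induction R) (simp_all add: o_def)

lemma length_concat_blocks:
  fixes R :: nat
  shows "length (concat (map (\<lambda>n. map (\<lambda>p. p \<circ> f ^^ n) ps) [0..<R])) = R * length ps"
  by (induction R) simp_all

lemma funpow_push:
  assumes "\<And>d. d \<in> N \<Longrightarrow> \<exists>d'\<in>N. f \<circ> d = d' \<circ> f" "d \<in> N"
  shows "\<exists>d'\<in>N. f ^^ n \<circ> d = d' \<circ> f ^^ n"
proof (induction n)
  case 0
  then show ?case using assms(2) by auto
next
  case (Suc n)
  then obtain d' where d': "d' \<in> N" "f ^^ n \<circ> d = d' \<circ> f ^^ n" by blast
  obtain d'' where d'': "d'' \<in> N" "f \<circ> d' = d'' \<circ> f" using assms(1) d'(1) by blast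
  have "f ^^ Suc n \<circ> d = f \<circ> (f ^^ n \<circ> d)"
    by (simp add: comp_assoc)
  also have "\<dots> = (f \<circ> d') \<circ> f ^^ n"
    by (simp add: d'(2) comp_assoc)
  also have "\<dots> = d'' \<circ> f ^^ Suc n"
    by (simp add: d''(2) comp_assoc)
  finally show ?case using d'' by blast
qed

text \<open>The averages for a cyclic extension are \<open>p \<circ> f ^^ n\<close> with \<open>p\<close> from an average on \<open>N\<close> and
  \<open>n < R\<close>. Multiplying by \<open>f\<close> shifts the exponent, which costs only the two end blocks.
  Multiplying by \<open>d \<in> N\<close> and moving \<open>d\<close> to the left through \<open>f ^^ n\<close> turns it into one of finitely
  many elements of \<open>N\<close>, for all of which the average on \<open>N\<close> was chosen almost invariant.\<close>

lemma right_Folner_cyclic_extension: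
  assumes N: "right_Folner N"
    and push: "\<And>d. d \<in> N \<Longrightarrow> \<exists>d'\<in>N. f \<circ> d = d' \<circ> f"
  shows "right_Folner {d \<circ> f ^^ n | d n. d \<in> N}"
  unfolding right_Folner_def
proof (intro allI impI)
  fix D and e :: real
  assume D: "finite D" "D \<subseteq> {d \<circ> f ^^ n | d n. d \<in> N}" and e: "0 < e"
  then have "\<forall>x\<in>D. \<exists>d n. d \<in> N \<and> x = d \<circ> f ^^ n" by blast
  then obtain b k where bk: "\<And>x. x \<in> D \<Longrightarrow> b x \<in> N \<and> x = b x \<circ> f ^^ (k x)" by metis
  define M where "M = Max (insert 0 (k ` D))"
  have M: "k x \<le> M" if "x \<in> D" for x
    using that D(1) by (auto simp: M_def)
  \<comment> \<open>An element \<open>d \<circ> f ^^ n\<close> of \<open>D\<close> will cost one error for \<open>d\<close> and \<open>n \<le> M\<close> errors for \<open>f\<close>.\<close>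
  define e0 where "e0 = e / (real M + 1)"
  have e0: "0 < e0" using e by (simp add: e0_def)
  obtain R :: nat where R: "2 / e0 < real R" using reals_Archimedean2 by blast
  with e0 have R2: "2 \<le> e0 * real R" by (simp add: field_simps)
  then have Rpos: "0 < R" using R e0 by (auto intro!: Nat.gr0I)
  have "\<forall>n. \<forall>x\<in>D. \<exists>d'. d' \<in> N \<and> f ^^ n \<circ> b x = d' \<circ> f ^^ n"
    using funpow_push[OF push] bk by blast
  then obtain c where c: "\<And>n x. x \<in> D \<Longrightarrow> c n x \<in> N \<and> f ^^ n \<circ> b x = c n x \<circ> f ^^ n"
    by metis
  define E where "E = (\<lambda>(n, x). c n x) ` ({..<R} \<times> D)"
  have E: "finite E" "E \<subseteq> N" using D(1) c by (auto simp: E_def)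
  obtain ps where ps: "ps \<noteq> []" "set ps \<subseteq> N" and inv: "\<And>d. d \<in> E \<Longrightarrow> almost_invariant ps e0 d"
    using right_FolnerD[OF N E e0] by blast
  define qs where "qs = concat (map (\<lambda>n. map (\<lambda>p. p \<circ> f ^^ n) ps) [0..<R])"
  have len: "length qs = R * length ps"
    unfolding qs_def by (rule length_concat_blocks)
  have invf: "almost_invariant qs e0 f"
    unfolding almost_invariant_def
  proof (intro allI impI)
    fix h :: "('a \<Rightarrow> 'a) \<Rightarrow> real" assume h: "\<forall>x. \<bar>h x\<bar> \<le> 1"
    define g where "g n = (\<Sum>p\<leftarrow>ps. h (p \<circ> f ^^ n))" for n
    have "\<bar>g n\<bar> \<le> length ps" for n
    proof -
      have "\<bar>g n\<bar> \<le> (\<Sum>p\<leftarrow>ps. \<bar>h (p \<circ> f ^^ n)\<bar>)"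
        using sum_list_abs[of "map (\<lambda>p. h (p \<circ> f ^^ n)) ps"] by (simp add: g_def o_def)
      also have "\<dots> \<le> (\<Sum>p\<leftarrow>ps. 1)"
        using h by (intro sum_list_mono) simp
      finally show ?thesis by (simp add: sum_list_triv)
    qed
    from this[of R] this[of 0] have bound: "\<bar>g R - g 0\<bar> \<le> 2 * real (length ps)" by linarith
    have "(\<Sum>q\<leftarrow>qs. h (q \<circ> f)) = (\<Sum>n<R. g (Suc n))"
      unfolding qs_def g_def
      by (subst sum_list_concat_blocks) (simp add: comp_assoc funpow_swap1 funpow_Suc_right del: funpow.simps)
    moreover have "(\<Sum>q\<leftarrow>qs. h q) = (\<Sum>n<R. g n)"
      unfolding qs_def g_def by (rule sum_list_concat_blocks)
    ultimately have "(\<Sum>q\<leftarrow>qs. h (q \<circ> f)) - (\<Sum>q\<leftarrow>qs. h q) = g R - g 0"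
      by (simp add: sum_subtractf[symmetric] sum_lessThan_telescope)
    then have "\<bar>(\<Sum>q\<leftarrow>qs. h (q \<circ> f)) - (\<Sum>q\<leftarrow>qs. h q)\<bar> \<le> 2 * real (length ps)"
      using bound by simp
    also have "\<dots> \<le> e0 * real R * length ps"
      using R2 by (rule mult_right_mono) simp
    finally show "\<bar>(\<Sum>q\<leftarrow>qs. h (q \<circ> f)) - (\<Sum>q\<leftarrow>qs. h q)\<bar> \<le> e0 * length qs"
      by (simp add: len)
  qed
  have invb: "almost_invariant qs e0 (b x)" if x: "x \<in> D" for x
    unfolding almost_invariant_def
  proof (intro allI impI)
    fix h :: "('a \<Rightarrow> 'a) \<Rightarrow> real" assume h: "\<forall>x. \<bar>h x\<bar> \<le> 1"
    have "(\<Sum>q\<leftarrow>qs. h (q \<circ> b x)) = (\<Sum>n<R. \<Sum>p\<leftarrow>ps. h (p \<circ> c n x \<circ> f ^^ n))"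
      unfolding qs_def
      by (subst sum_list_concat_blocks[where h = "\<lambda>q. h (q \<circ> b x)"])
        (use c[OF x] in \<open>simp add: comp_assoc\<close>)
    moreover have "(\<Sum>q\<leftarrow>qs. h q) = (\<Sum>n<R. \<Sum>p\<leftarrow>ps. h (p \<circ> f ^^ n))"
      unfolding qs_def by (rule sum_list_concat_blocks)
    ultimately have "\<bar>(\<Sum>q\<leftarrow>qs. h (q \<circ> b x)) - (\<Sum>q\<leftarrow>qs. h q)\<bar> =
        \<bar>\<Sum>n<R. (\<Sum>p\<leftarrow>ps. h (p \<circ> c n x \<circ> f ^^ n)) - (\<Sum>p\<leftarrow>ps. h (p \<circ> f ^^ n))\<bar>"
      by (simp add: sum_subtractf)
    also have "\<dots> \<le> (\<Sum>n<R. \<bar>(\<Sum>p\<leftarrow>ps. h (p \<circ> c n x \<circ> f ^^ n)) - (\<Sum>p\<leftarrow>ps. h (p \<circ> f ^^ n))\<bar>)"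
      by (rule sum_abs)
    also have "\<dots> \<le> (\<Sum>n<R. e0 * length ps)"
    proof (rule sum_mono)
      fix n assume "n \<in> {..<R}"
      then have "almost_invariant ps e0 (c n x)"
        using x by (intro inv) (auto simp: E_def)
      from almost_invariantD[OF this, of "\<lambda>q. h (q \<circ> f ^^ n)"] h
      show "\<bar>(\<Sum>p\<leftarrow>ps. h (p \<circ> c n x \<circ> f ^^ n)) - (\<Sum>p\<leftarrow>ps. h (p \<circ> f ^^ n))\<bar> \<le> e0 * length ps"
        by blast
    qed
    finally show "\<bar>(\<Sum>q\<leftarrow>qs. h (q \<circ> b x)) - (\<Sum>q\<leftarrow>qs. h q)\<bar> \<le> e0 * length qs"
      by (simp add: len mult_ac)
  qed
  have "almost_invariant qs e x" if x: "x \<in> D" for x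
  proof -
    have "almost_invariant qs (e0 + real (k x) * e0) (b x \<circ> f ^^ k x)"
      by (rule almost_invariant_comp[OF invb[OF x] almost_invariant_funpow[OF invf]])
    moreover have "e0 + real (k x) * e0 \<le> e0 + real M * e0"
      using M[OF x] e0 by simp
    moreover have "e0 + real M * e0 = (real M + 1) * e0"
      by (simp add: algebra_simps)
    moreover have "(real M + 1) * e0 = e"
      by (simp add: e0_def)
    ultimately show ?thesis
      using bk[OF x] by (metis almost_invariant_mono)
  qed
  moreover have "qs \<noteq> []" using len ps(1) Rpos by auto
  moreover have "set qs \<subseteq> {d \<circ> f ^^ n | d n. d \<in> N}"
    using ps(2) by (auto simp: qs_def)
  ultimately show "\<exists>ps. ps \<noteq> [] \<and> set ps \<subseteq> {d \<circ> f ^^ n | d n. d \<in> N} \<and>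
      (\<forall>d\<in>D. almost_invariant ps e d)"
    by blast
qed

lemma funpow_mem_monoid:
  assumes "comp_closed U" "id \<in> U" "f \<in> U"
  shows "f ^^ n \<in> U"
proof (induction n)
  case 0
  show ?case using assms(2) by (simp add: id_def)
next
  case (Suc n)
  then show ?case using assms(1,3) unfolding comp_closed_def funpow.simps by blast
qed

text \<open>This is the closure of amenability under abelian extensions. The condition is local, so it
  suffices to adjoin finitely many elements of \<open>U\<close> to \<open>N\<close>, one at a time. The commutation rule
  makes every intermediate monoid closed under the passage of \<open>d\<close> through the new generator,
  because the correction \<open>v\<close> already lies in \<open>N\<close>.\<close>

lemma right_Folner_abelian_extension:
  assumes N: "right_Folner N" "id \<in> N" "N \<subseteq> U" "comp_closed N" and U: "comp_closed U"
    and comm: "\<And>f g. f \<in> U \<Longrightarrow> g \<in> U \<Longrightarrow> \<exists>v\<in>N. f \<circ> g = v \<circ> g \<circ> f"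
  shows "right_Folner U"
proof -
  have idU: "id \<in> U" using N by blast
  have ex: "\<exists>M. N \<subseteq> M \<and> D \<subseteq> M \<and> M \<subseteq> U \<and> comp_closed M \<and> right_Folner M"
    if "finite D" "D \<subseteq> U" for D
    using that
  proof (induction D rule: finite_induct)
    case empty
    then show ?case using N by blast
  next
    case (insert f D)
    then obtain M where M: "N \<subseteq> M" "D \<subseteq> M" "M \<subseteq> U" "comp_closed M" "right_Folner M"
      by auto
    have f: "f \<in> U" using insert by blast
    have push: "\<exists>d'\<in>M. f \<circ> d = d' \<circ> f" if "d \<in> M" for d
    proof -
      have "d \<in> U" using that M(3) by blast
      then obtain v where "v \<in> N" "f \<circ> d = v \<circ> d \<circ> f" using comm[OF f] by blast
      moreover have "v \<circ> d \<in> M" using M(1,4) that \<open>v \<in> N\<close> unfolding comp_closed_def by blast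
      ultimately show ?thesis by blast
    qed
    let ?M = "{d \<circ> f ^^ n | d n. d \<in> M}"
    have "d \<in> ?M" if "d \<in> M" for d
    proof -
      have "d = d \<circ> f ^^ 0" by simp
      then show ?thesis using that by blast
    qed
    then have "M \<subseteq> ?M" by blast
    moreover have "f \<in> ?M"
    proof -
      have "f = id \<circ> f ^^ 1" by simp
      then show ?thesis using N M by blast
    qed
    moreover have "?M \<subseteq> U"
    proof
      fix x assume "x \<in> ?M"
      then obtain d n where "x = d \<circ> f ^^ n" "d \<in> M" by blast
      then show "x \<in> U"
        using M(3) U funpow_mem_monoid[OF U idU f, of n] unfolding comp_closed_def by blast
    qed
    moreover have "comp_closed ?M"
      unfolding comp_closed_def
    proof (intro ballI)
      fix x y assume "x \<in> ?M" "y \<in> ?M"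
      then obtain d n d' m where x: "x = d \<circ> f ^^ n" "d \<in> M" and y: "y = d' \<circ> f ^^ m" "d' \<in> M"
        by blast
      obtain d'' where d'': "d'' \<in> M" "f ^^ n \<circ> d' = d'' \<circ> f ^^ n"
        using funpow_push[OF push y(2)] by blast
      have "x \<circ> y = d \<circ> (f ^^ n \<circ> d') \<circ> f ^^ m"
        by (simp add: x y comp_assoc)
      also have "\<dots> = (d \<circ> d'') \<circ> f ^^ (n + m)"
        by (simp add: d''(2) funpow_add comp_assoc)
      finally show "x \<circ> y \<in> ?M"
        using x(2) d''(1) M(4) unfolding comp_closed_def by blast
    qed
    moreover have "right_Folner ?M"
      using right_Folner_cyclic_extension[OF M(5) push] .
    ultimately show ?case using M by (intro exI[of _ ?M]) auto
  qed
  show ?thesis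
    unfolding right_Folner_def
  proof (intro allI impI)
    fix D and e :: real assume D: "finite D" "D \<subseteq> U" and e: "0 < e"
    obtain M where M: "D \<subseteq> M" "M \<subseteq> U" "right_Folner M" using ex[OF D] by blast
    obtain ps where "ps \<noteq> []" "set ps \<subseteq> M" "\<And>d. d \<in> D \<Longrightarrow> almost_invariant ps e d"
      using right_FolnerD[OF M(3) D(1) M(1) e] by blast
    then show "\<exists>ps. ps \<noteq> [] \<and> set ps \<subseteq> U \<and> (\<forall>d\<in>D. almost_invariant ps e d)"
      using M by blast
  qed
qed

lemma right_Folner_id: "right_Folner {id}"
  unfolding right_Folner_def
proof (intro allI impI)
  fix D :: "('a \<Rightarrow> 'a) set" and e :: real assume D: "D \<subseteq> {id}" "0 < e"
  then have "\<forall>d\<in>D. almost_invariant [id] e d"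
    by (auto simp: almost_invariant_def)
  then show "\<exists>ps. ps \<noteq> [] \<and> set ps \<subseteq> {id} \<and> (\<forall>d\<in>D. almost_invariant ps e d)"
    by (intro exI[of _ "[id]"]) simp
qed

text \<open>A subsemigroup \<open>S\<close> of \<open>W\<close> can be negligible for an invariant mean of \<open>W\<close>, so a mean on
  \<open>W\<close> need not restrict to \<open>S\<close>. Finite averages do pass to \<open>S\<close>, since a single left
  multiplication moves all their entries into \<open>S\<close>.\<close>

lemma right_Folner_absorbing_subset:
  assumes W: "right_Folner W" "S \<subseteq> W"
    and absorb: "\<And>E. finite E \<Longrightarrow> E \<subseteq> W \<Longrightarrow> \<exists>s. (\<circ>) s ` E \<subseteq> S"
  shows "right_Folner S"
  unfolding right_Folner_def
proof (intro allI impI)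
  fix D and e :: real assume D: "finite D" "D \<subseteq> S" and e: "0 < e"
  obtain ps where ps: "ps \<noteq> []" "set ps \<subseteq> W" "\<And>d. d \<in> D \<Longrightarrow> almost_invariant ps e d"
    using right_FolnerD[OF W(1) D(1) _ e] D(2) W(2) by blast
  obtain s where s: "(\<circ>) s ` set ps \<subseteq> S" using absorb[of "set ps"] ps(2) by auto
  then show "\<exists>ps. ps \<noteq> [] \<and> set ps \<subseteq> S \<and> (\<forall>d\<in>D. almost_invariant ps e d)"
    using ps almost_invariant_map_comp[of ps e _ s]
    by (intro exI[of _ "map ((\<circ>) s) ps"]) auto
qed

section \<open>From averages to an invariant mean\<close>

text \<open>Every set function with values in the unit interval is a point of a Tychonoff cube.
  The finitely additive probabilities that are invariant under \<open>f\<close> up to \<open>inverse (Suc n)\<close> form a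
  closed subset of it, for each pair \<open>(f, n)\<close>. Finitely many of these sets have a common point,
  namely an average, so all of them do.\<close>

lemma right_amenable_if_right_Folner:
  fixes S :: "('a \<Rightarrow> 'a) set"
  assumes S: "right_Folner S"
  shows "right_amenable S"
proof -
  define K :: "(('a \<Rightarrow> 'a) set \<Rightarrow> real) set" where "K = PiE UNIV (\<lambda>_. {0..1})"
  define C where "C = (\<lambda>(f, n::nat). {\<mu> :: ('a \<Rightarrow> 'a) set \<Rightarrow> real.
      (\<forall>A B. A \<inter> B = {} \<longrightarrow> \<mu> (A \<union> B) = \<mu> A + \<mu> B) \<and> \<mu> S = 1 \<and>
      (\<forall>A. \<bar>\<mu> ((\<lambda>g. g \<circ> f) -` A \<inter> S) - \<mu> A\<bar> \<le> inverse (Suc n))})"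
  have "compactin (product_topology (\<lambda>_. euclidean) UNIV) K"
    unfolding K_def by (subst compactin_PiE) auto
  then have K: "compact K"
    by (simp add: euclidean_product_topology)
  have Ccl: "closed (C fn)" for fn
    unfolding C_def split_beta
    by (intro closed_Collect_conj closed_Collect_all closed_Collect_imp closed_Collect_eq
        closed_Collect_le open_Collect_const continuous_intros continuous_on_product_coordinates)
  have fip: "K \<inter> \<Inter> (C ` P) \<noteq> {}" if P: "finite P" "P \<subseteq> S \<times> UNIV" for P
  proof -
    define n where "n = Max (insert 0 (snd ` P))"
    have n: "k \<le> n" if "(f, k) \<in> P" for f k
      unfolding n_def using that P(1) by (intro Max_ge) force+
    obtain ps where ps: "ps \<noteq> []" "set ps \<subseteq> S"
      and inv: "\<And>d. d \<in> fst ` P \<Longrightarrow> almost_invariant ps (inverse (Suc n)) d"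
    proof (rule right_FolnerD[OF S, of "fst ` P" "inverse (Suc n)"])
      show "finite (fst ` P)" "fst ` P \<subseteq> S" using P by auto
    qed auto
    define \<mu> :: "('a \<Rightarrow> 'a) set \<Rightarrow> real"
      where "\<mu> A = (\<Sum>p\<leftarrow>ps. indicator A p) / length ps" for A
    have len: "0 < real (length ps)" using ps by simp
    have "\<mu> \<in> K"
    proof -
      have "0 \<le> (\<Sum>p\<leftarrow>ps. indicator A p :: real)" for A
        by (intro sum_list_nonneg) auto
      moreover have "(\<Sum>p\<leftarrow>ps. indicator A p :: real) \<le> (\<Sum>p\<leftarrow>ps. 1)" for A
        by (intro sum_list_mono) (auto simp: indicator_def)
      ultimately show ?thesis
        using len by (auto simp: K_def \<mu>_def sum_list_triv)
    qed
    moreover have "\<mu> \<in> C (f, k)" if fk: "(f, k) \<in> P" for f k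
    proof -
      have "\<mu> (A \<union> B) = \<mu> A + \<mu> B" if "A \<inter> B = {}" for A B
        using that
        by (simp add: \<mu>_def indicator_add[symmetric] sum_list_addf add_divide_distrib)
      moreover have "\<mu> S = 1"
      proof -
        have "(\<Sum>p\<leftarrow>ps. indicator S p :: real) = (\<Sum>p\<leftarrow>ps. 1)"
          using ps(2) by (intro arg_cong[of _ _ sum_list] map_cong) auto
        then show ?thesis using ps(1) by (simp add: \<mu>_def sum_list_triv)
      qed
      moreover have "\<bar>\<mu> ((\<lambda>g. g \<circ> f) -` A \<inter> S) - \<mu> A\<bar> \<le> inverse (Suc k)" for A
      proof -
        have eq: "(\<Sum>p\<leftarrow>ps. indicator ((\<lambda>g. g \<circ> f) -` A \<inter> S) p :: real) =
            (\<Sum>p\<leftarrow>ps. indicator A (p \<circ> f))"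
          using ps(2) by (intro arg_cong[of _ _ sum_list] map_cong) (auto simp: indicator_def)
        have "f \<in> fst ` P" using fk by force
        from almost_invariantD[OF inv[OF this], of "indicator A"]
        have "\<bar>(\<Sum>p\<leftarrow>ps. indicator A (p \<circ> f) :: real) - (\<Sum>p\<leftarrow>ps. indicator A p)\<bar>
            \<le> inverse (Suc n) * length ps"
          by (auto simp: indicator_def)
        then have "\<bar>(\<Sum>p\<leftarrow>ps. indicator A (p \<circ> f) :: real) - (\<Sum>p\<leftarrow>ps. indicator A p)\<bar> / length ps
            \<le> inverse (Suc n)"
          using len by (simp add: pos_divide_le_eq)
        then have "\<bar>\<mu> ((\<lambda>g. g \<circ> f) -` A \<inter> S) - \<mu> A\<bar> \<le> inverse (Suc n)"
          unfolding \<mu>_def eq using len by (simp add: diff_divide_distrib[symmetric])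
        also have "\<dots> \<le> inverse (Suc k)"
          using n[OF fk] by (simp add: le_imp_inverse_le)
        finally show ?thesis .
      qed
      ultimately show ?thesis by (auto simp: C_def)
    qed
    ultimately show ?thesis by fast
  qed
  have "K \<inter> \<Inter> (C ` (S \<times> UNIV)) \<noteq> {}"
  proof (rule compact_imp_fip[OF K])
    fix F' assume "finite F'" "F' \<subseteq> C ` (S \<times> UNIV)"
    then obtain P where "finite P" "P \<subseteq> S \<times> UNIV" "F' = C ` P"
      by (meson finite_subset_image)
    then show "K \<inter> \<Inter> F' \<noteq> {}" using fip by blast
  qed (use Ccl in blast)
  then obtain \<mu> where \<mu>K: "\<mu> \<in> K" and \<mu>C: "\<And>f n. f \<in> S \<Longrightarrow> \<mu> \<in> C (f, n)"
    by blast
  have S_ne: "S \<noteq> {}"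
    using right_FolnerD[OF S, of "{}" 1] by fastforce
  have "\<mu> ((\<lambda>g. g \<circ> f) -` A \<inter> S) = \<mu> A" if "f \<in> S" for f A
  proof (rule ccontr)
    assume "\<mu> ((\<lambda>g. g \<circ> f) -` A \<inter> S) \<noteq> \<mu> A"
    then have "0 < \<bar>\<mu> ((\<lambda>g. g \<circ> f) -` A \<inter> S) - \<mu> A\<bar>" by simp
    then obtain n where "inverse (Suc n) < \<bar>\<mu> ((\<lambda>g. g \<circ> f) -` A \<inter> S) - \<mu> A\<bar>"
      using reals_Archimedean by blast
    moreover have "\<bar>\<mu> ((\<lambda>g. g \<circ> f) -` A \<inter> S) - \<mu> A\<bar> \<le> inverse (Suc n)"
      using \<mu>C[OF that, of n] unfolding C_def by blast
    ultimately show False by linarith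
  qed
  moreover have "0 \<le> \<mu> A" for A using \<mu>K by (auto simp: K_def)
  moreover have "additive (Pow S) \<mu>" "\<mu> S = 1"
    using S_ne \<mu>C by (auto simp: C_def additive_def)
  ultimately show ?thesis
    unfolding right_amenable_def by (intro exI[of _ \<mu>]) blast
qed

section \<open>The affine group\<close>

interpretation Aff: group Aff
  by (rule group_Aff)

lemma Aff_mult [simp]: "x \<otimes>\<^bsub>Aff\<^esub> y = x \<circ> y"
  by (simp add: Aff_def)

lemma Aff_one [simp]: "\<one>\<^bsub>Aff\<^esub> = id"
  by (simp add: Aff_def)

lemma AffE:
  assumes "\<gamma> \<in> carrier Aff"
  obtains a b where "a \<noteq> 0" "\<gamma> = (\<lambda>z. a * z + b)"
  using assms unfolding Aff_def by auto

lemma Aff_holomorphic: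
  assumes "\<gamma> \<in> carrier Aff"
  shows "\<gamma> holomorphic_on UNIV"
  using assms by (auto elim!: AffE intro!: holomorphic_intros)

lemma Aff_inv_comp:
  assumes "\<gamma> \<in> carrier Aff"
  shows "inv\<^bsub>Aff\<^esub> \<gamma> \<circ> \<gamma> = id" "\<gamma> \<circ> inv\<^bsub>Aff\<^esub> \<gamma> = id"
  using Aff.l_inv[OF assms] Aff.r_inv[OF assms] by simp_all

text \<open>The linear part is a homomorphism to an abelian group, so the commutator of two affine maps
  has linear part one.\<close>

lemma Aff_commutator_translation:
  assumes "v \<in> carrier Aff" "f \<in> carrier Aff" "g \<in> carrier Aff" "f \<circ> g = v \<circ> g \<circ> f"
  shows "\<exists>b. v = (\<lambda>z. z + b)"
proof -
  obtain p q where v: "v = (\<lambda>z. p * z + q)" using assms(1) by (rule AffE)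
  obtain a b where f: "a \<noteq> 0" "f = (\<lambda>z. a * z + b)" using assms(2) by (rule AffE)
  obtain c d where g: "c \<noteq> 0" "g = (\<lambda>z. c * z + d)" using assms(3) by (rule AffE)
  have eq: "a * (c * z + d) + b = p * (c * (a * z + b) + d) + q" for z
    using fun_cong[OF assms(4), of z] by (simp add: v f g)
  have "p * (a * c) = (p * (c * (a * 1 + b) + d) + q) - (p * (c * (a * 0 + b) + d) + q)"
    by (simp add: algebra_simps)
  also have "\<dots> = (a * (c * 1 + d) + b) - (a * (c * 0 + d) + b)"
    by (simp only: eq)
  finally have "p * (a * c) = a * c" by (simp add: algebra_simps)
  then have "p = 1" using f g by simp
  then show ?thesis using v by auto
qed

lemma entire_compose:
  assumes "f holomorphic_on UNIV" "g holomorphic_on UNIV"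
  shows "f \<circ> g holomorphic_on UNIV"
  using assms by (intro holomorphic_on_compose_gen[of g UNIV f UNIV]) auto

text \<open>A non-constant entire map is open, and two entire maps that agree on a non-empty open set are
  equal.\<close>

lemma entire_right_cancel:
  assumes c: "c holomorphic_on UNIV" "\<not> c constant_on UNIV"
    and "a holomorphic_on UNIV" "b holomorphic_on UNIV" and eq: "a \<circ> c = b \<circ> c"
  shows "a = b"
proof
  fix z
  have "open (range c)"
    using open_mapping_thm[OF c(1), of UNIV] c(2) by auto
  moreover have "a w = b w" if "w \<in> range c" for w
    using that fun_cong[OF eq] by auto
  ultimately show "a z = b z"
    using assms(3,4) analytic_continuation_open[of "range c" UNIV a b z] by auto
qed

section \<open>The left Ore condition\<close>

definition left_Ore :: "('a \<Rightarrow> 'a) set \<Rightarrow> bool" where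
  "left_Ore S \<longleftrightarrow> (\<forall>f\<in>S. \<forall>g\<in>S. \<exists>a\<in>S. \<exists>b\<in>S. a \<circ> f = b \<circ> g)"

locale nearly_abelian_semigroup =
  fixes S :: "(complex \<Rightarrow> complex) set"
  assumes nearly_abelian: "nearly_abelian S"
begin

lemma comp_mem: "f \<in> S \<Longrightarrow> g \<in> S \<Longrightarrow> f \<circ> g \<in> S"
  using nearly_abelian by (simp add: nearly_abelian_def comp_semigroup_def comp_closed_def)

lemma S_nonempty: "S \<noteq> {}"
  using nearly_abelian by (simp add: nearly_abelian_def comp_semigroup_def)

lemma S_holomorphic: "f \<in> S \<Longrightarrow> f holomorphic_on UNIV"
  using nearly_abelian by (simp add: nearly_abelian_def)

lemma right_cancel:
  assumes "a \<circ> c = b \<circ> c" "c \<in> S" "a holomorphic_on UNIV" "b holomorphic_on UNIV"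
  shows "a = b"
  using entire_right_cancel[of c a b] assms nearly_abelian by (auto simp: nearly_abelian_def)

lemma commutatorE:
  assumes "f \<in> S" "g \<in> S"
  obtains \<gamma> where "\<gamma> \<in> commutator_set S" "f \<circ> g = \<gamma> \<circ> g \<circ> f"
proof -
  obtain \<gamma> where "\<gamma> \<in> carrier Aff" "f \<circ> g = \<gamma> \<circ> g \<circ> f"
    using nearly_abelian assms unfolding nearly_abelian_def by blast
  then show ?thesis using assms that unfolding commutator_set_def by blast
qed

lemma commutator_set_Aff: "commutator_set S \<subseteq> carrier Aff"
  by (auto simp: commutator_set_def)

lemma commutator_group_Aff: "\<gamma> \<in> commutator_group S \<Longrightarrow> \<gamma> \<in> carrier Aff"
  using Aff.generate_in_carrier[OF commutator_set_Aff] by (simp add: commutator_group_def)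

lemma commutator_set_group: "\<gamma> \<in> commutator_set S \<Longrightarrow> \<gamma> \<in> commutator_group S"
  by (simp add: commutator_group_def generate.incl)

lemma commutator_group_id: "id \<in> commutator_group S"
  using generate.one[of Aff "commutator_set S"] by (simp add: commutator_group_def)

lemma commutator_group_comp:
  "\<gamma> \<in> commutator_group S \<Longrightarrow> \<delta> \<in> commutator_group S \<Longrightarrow> \<gamma> \<circ> \<delta> \<in> commutator_group S"
  using generate.eng[of \<gamma> Aff "commutator_set S" \<delta>] by (simp add: commutator_group_def)

lemma commutator_group_inv:
  "\<gamma> \<in> commutator_group S \<Longrightarrow> inv\<^bsub>Aff\<^esub> \<gamma> \<in> commutator_group S"
  using Aff.generate_m_inv_closed[OF commutator_set_Aff] by (simp add: commutator_group_def)

text \<open>Write \<open>[a, b]\<close> for the affine map with \<open>a \<circ> b = [a, b] \<circ> b \<circ> a\<close>. Reordering \<open>g \<circ> f \<circ> h\<close> to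
  end in \<open>h \<circ> g\<close>, once in one step and once through \<open>f \<circ> g \<circ> h\<close>, and cancelling \<open>h \<circ> g\<close> gives
  \<open>[g, f \<circ> h] \<circ> f = [g, f] \<circ> f \<circ> [g, h]\<close>.\<close>

lemma push_commutator:
  assumes f: "f \<in> S" and \<gamma>: "\<gamma> \<in> commutator_set S"
  shows "\<exists>\<gamma>'\<in>commutator_group S. f \<circ> \<gamma> = \<gamma>' \<circ> f"
proof -
  obtain g h where gh: "g \<in> S" "h \<in> S" "g \<circ> h = \<gamma> \<circ> h \<circ> g" "\<gamma> \<in> carrier Aff"
    using \<gamma> by (auto simp: commutator_set_def)
  obtain \<delta> where \<delta>: "\<delta> \<in> commutator_set S" "g \<circ> f = \<delta> \<circ> f \<circ> g"
    using commutatorE[OF gh(1) f] .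
  obtain \<epsilon> where \<epsilon>: "\<epsilon> \<in> commutator_set S" "g \<circ> (f \<circ> h) = \<epsilon> \<circ> (f \<circ> h) \<circ> g"
    using commutatorE[OF gh(1) comp_mem[OF f gh(2)]] .
  have \<delta>A: "\<delta> \<in> carrier Aff" and \<epsilon>A: "\<epsilon> \<in> carrier Aff"
    using \<delta> \<epsilon> commutator_set_Aff by auto
  have "(\<epsilon> \<circ> f) \<circ> (h \<circ> g) = g \<circ> f \<circ> h"
    using \<epsilon>(2) by (simp add: comp_assoc)
  also have "\<dots> = \<delta> \<circ> f \<circ> (g \<circ> h)"
    by (simp only: \<delta>(2) comp_assoc)
  also have "\<dots> = (\<delta> \<circ> f \<circ> \<gamma>) \<circ> (h \<circ> g)"
    by (simp only: gh(3) comp_assoc)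
  finally have "\<epsilon> \<circ> f = \<delta> \<circ> f \<circ> \<gamma>"
    by (rule right_cancel)
      (intro comp_mem gh entire_compose Aff_holomorphic \<delta>A \<epsilon>A S_holomorphic f)+
  then have "inv\<^bsub>Aff\<^esub> \<delta> \<circ> (\<delta> \<circ> (f \<circ> \<gamma>)) = inv\<^bsub>Aff\<^esub> \<delta> \<circ> (\<epsilon> \<circ> f)"
    by (simp add: comp_assoc)
  then have "f \<circ> \<gamma> = (inv\<^bsub>Aff\<^esub> \<delta> \<circ> \<epsilon>) \<circ> f"
    by (simp only: comp_assoc[symmetric] Aff_inv_comp[OF \<delta>A] id_comp)
  moreover have "inv\<^bsub>Aff\<^esub> \<delta> \<circ> \<epsilon> \<in> commutator_group S"
    by (intro commutator_group_comp commutator_group_inv commutator_set_group \<delta>(1) \<epsilon>(1))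
  ultimately show ?thesis by blast
qed

lemma push_commutator_group:
  assumes f: "f \<in> S" and "\<gamma> \<in> commutator_group S"
  shows "\<exists>\<gamma>'\<in>commutator_group S. f \<circ> \<gamma> = \<gamma>' \<circ> f"
proof -
  from assms(2) have "\<gamma> \<in> generate Aff (commutator_set S)"
    by (simp add: commutator_group_def)
  then show ?thesis
  proof (induction rule: generate.induct)
    case one
    show ?case using commutator_group_id by (intro bexI[of _ id]) auto
  next
    case (incl \<gamma>)
    then show ?case by (rule push_commutator[OF f])
  next
    case (inv \<gamma>)
    then obtain \<gamma>' where \<gamma>': "\<gamma>' \<in> commutator_group S" "f \<circ> \<gamma> = \<gamma>' \<circ> f"
      using push_commutator[OF f] by blast
    have A: "\<gamma> \<in> carrier Aff" "\<gamma>' \<in> carrier Aff"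
      using inv commutator_set_Aff commutator_group_Aff \<gamma>'(1) by auto
    have "inv\<^bsub>Aff\<^esub> \<gamma>' \<circ> (f \<circ> \<gamma>) \<circ> inv\<^bsub>Aff\<^esub> \<gamma> = inv\<^bsub>Aff\<^esub> \<gamma>' \<circ> (\<gamma>' \<circ> f) \<circ> inv\<^bsub>Aff\<^esub> \<gamma>"
      by (simp only: \<gamma>'(2))
    then have "inv\<^bsub>Aff\<^esub> \<gamma>' \<circ> f \<circ> (\<gamma> \<circ> inv\<^bsub>Aff\<^esub> \<gamma>) = (inv\<^bsub>Aff\<^esub> \<gamma>' \<circ> \<gamma>') \<circ> f \<circ> inv\<^bsub>Aff\<^esub> \<gamma>"
      by (simp only: comp_assoc)
    then have "f \<circ> inv\<^bsub>Aff\<^esub> \<gamma> = inv\<^bsub>Aff\<^esub> \<gamma>' \<circ> f"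
      by (simp only: Aff_inv_comp[OF A(1)] Aff_inv_comp[OF A(2)] comp_id id_comp)
    then show ?case using commutator_group_inv[OF \<gamma>'(1)] by blast
  next
    case (eng \<gamma> \<delta>)
    then obtain \<gamma>' \<delta>' where *: "\<gamma>' \<in> commutator_group S" "f \<circ> \<gamma> = \<gamma>' \<circ> f"
      "\<delta>' \<in> commutator_group S" "f \<circ> \<delta> = \<delta>' \<circ> f" by blast
    have "f \<circ> (\<gamma> \<circ> \<delta>) = \<gamma>' \<circ> (f \<circ> \<delta>)"
      by (simp only: comp_assoc[symmetric] *(2))
    also have "\<dots> = (\<gamma>' \<circ> \<delta>') \<circ> f"
      by (simp only: comp_assoc *(4))
    finally show ?case using commutator_group_comp[OF *(1,3)] by (simp only: Aff_mult) blast
  qed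
qed

text \<open>If \<open>f \<circ> g = \<gamma> \<circ> g \<circ> f\<close>, a common left multiple of \<open>f \<circ> g\<close> and \<open>g \<circ> f\<close> displays \<open>\<gamma>\<close> as a left
  fraction of elements of \<open>S\<close>. Left fractions of \<open>S\<close> form a group by the Ore condition.\<close>

lemma commutator_group_left_fraction:
  assumes Ore: "left_Ore S" and "\<gamma> \<in> commutator_group S"
  shows "\<exists>u\<in>S. u \<circ> \<gamma> \<in> S"
proof -
  have gen: "\<exists>u\<in>S. u \<circ> \<gamma> \<in> S" if "\<gamma> \<in> commutator_set S" for \<gamma>
  proof -
    obtain f g where fg: "f \<in> S" "g \<in> S" "f \<circ> g = \<gamma> \<circ> g \<circ> f" "\<gamma> \<in> carrier Aff"
      using \<open>\<gamma> \<in> commutator_set S\<close> by (auto simp: commutator_set_def)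
    obtain p q where pq: "p \<in> S" "q \<in> S" "p \<circ> (f \<circ> g) = q \<circ> (g \<circ> f)"
      using Ore comp_mem[OF fg(1,2)] comp_mem[OF fg(2,1)] unfolding left_Ore_def by meson
    have "(p \<circ> \<gamma>) \<circ> (g \<circ> f) = q \<circ> (g \<circ> f)"
      using pq(3) by (simp only: fg(3) comp_assoc)
    then have "p \<circ> \<gamma> = q"
      by (rule right_cancel) (intro comp_mem fg entire_compose Aff_holomorphic S_holomorphic pq)+
    then show ?thesis using pq by blast
  qed
  from assms(2) have "\<gamma> \<in> generate Aff (commutator_set S)"
    by (simp add: commutator_group_def)
  then show ?thesis
  proof (induction rule: generate.induct)
    case one
    show ?case using S_nonempty by auto
  next
    case (incl \<gamma>)
    then show ?case by (rule gen)
  next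
    case (inv \<gamma>)
    then obtain u where u: "u \<in> S" "u \<circ> \<gamma> \<in> S" using gen by blast
    have "\<gamma> \<in> carrier Aff" using inv commutator_set_Aff by blast
    then have "(u \<circ> \<gamma>) \<circ> inv\<^bsub>Aff\<^esub> \<gamma> = u"
      by (simp only: comp_assoc Aff_inv_comp comp_id)
    then show ?case using u by (intro bexI[of _ "u \<circ> \<gamma>"]) (simp_all only:)
  next
    case (eng \<gamma> \<delta>)
    then obtain u v where uv: "u \<in> S" "u \<circ> \<gamma> \<in> S" "v \<in> S" "v \<circ> \<delta> \<in> S" by blast
    then obtain a b where ab: "a \<in> S" "b \<in> S" "a \<circ> (u \<circ> \<gamma>) = b \<circ> v"
      using Ore unfolding left_Ore_def by meson
    have "(a \<circ> u) \<circ> (\<gamma> \<circ> \<delta>) = (a \<circ> (u \<circ> \<gamma>)) \<circ> \<delta>"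
      by (simp only: comp_assoc)
    also have "\<dots> = b \<circ> (v \<circ> \<delta>)"
      by (simp only: ab(3) comp_assoc)
    finally show ?case
      using comp_mem[OF ab(1) uv(1)] comp_mem[OF ab(2) uv(4)] by (simp only: Aff_mult) metis
  qed
qed

section \<open>Amenability under the left Ore condition\<close>

lemma right_Folner_commutator_group: "right_Folner (commutator_group S)"
proof -
  define V where "V = {\<gamma> \<in> commutator_group S. \<exists>b. \<gamma> = (\<lambda>z. z + b)}"
  have "(id :: complex \<Rightarrow> complex) = (\<lambda>z. z + 0)" by auto
  then have V_id: "id \<in> V" using commutator_group_id unfolding V_def by blast
  have V_comp: "comp_closed V"
    unfolding comp_closed_def
  proof (intro ballI)
    fix f g assume "f \<in> V" "g \<in> V"
    then obtain a b where fg: "f = (\<lambda>z. z + a)" "g = (\<lambda>z. z + b)"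
      and mem: "f \<circ> g \<in> commutator_group S"
      using commutator_group_comp unfolding V_def by blast
    have "f \<circ> g = (\<lambda>z. z + (b + a))" by (auto simp: fg)
    then show "f \<circ> g \<in> V" using mem unfolding V_def by blast
  qed
  have "right_Folner V"
  proof (rule right_Folner_abelian_extension[OF right_Folner_id])
    fix f g assume "f \<in> V" "g \<in> V"
    then have "f \<circ> g = id \<circ> g \<circ> f" by (auto simp: V_def)
    then show "\<exists>v\<in>{id}. f \<circ> g = v \<circ> g \<circ> f" by blast
  qed (use V_id V_comp in \<open>auto simp: comp_closed_def\<close>)
  then show ?thesis
  proof (rule right_Folner_abelian_extension)
    fix f g assume f: "f \<in> commutator_group S" and g: "g \<in> commutator_group S"
    let ?v = "f \<circ> g \<circ> inv\<^bsub>Aff\<^esub> (g \<circ> f)"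
    have gf: "g \<circ> f \<in> commutator_group S" by (rule commutator_group_comp[OF g f])
    have v: "?v \<in> commutator_group S"
      by (intro commutator_group_comp commutator_group_inv f g)
    have "?v \<circ> g \<circ> f = f \<circ> g \<circ> (inv\<^bsub>Aff\<^esub> (g \<circ> f) \<circ> (g \<circ> f))"
      by (simp only: comp_assoc)
    then have eq: "f \<circ> g = ?v \<circ> g \<circ> f"
      by (simp only: Aff_inv_comp[OF commutator_group_Aff[OF gf]] comp_id)
    have "?v \<in> V"
      using v Aff_commutator_translation[OF _ _ _ eq] commutator_group_Aff[OF v]
        commutator_group_Aff[OF f] commutator_group_Aff[OF g] unfolding V_def by blast
    then show "\<exists>v\<in>V. f \<circ> g = v \<circ> g \<circ> f" using eq by blast
  qed (use V_id V_comp commutator_group_comp in \<open>auto simp: V_def comp_closed_def\<close>)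
qed

text \<open>Adjoining \<open>id\<close> to \<open>S\<close> makes the commutator group itself a part of this set, which is the
  extended semigroup with its elements in normal form.\<close>

definition group_translates :: "(complex \<Rightarrow> complex) set" where
  "group_translates = {\<gamma> \<circ> f | \<gamma> f. \<gamma> \<in> commutator_group S \<and> f \<in> insert id S}"

lemma group_translates_I: "\<gamma> \<in> commutator_group S \<Longrightarrow> f \<in> insert id S \<Longrightarrow> \<gamma> \<circ> f \<in> group_translates"
  unfolding group_translates_def by blast

lemma push_insert_id:
  assumes "f \<in> insert id S" "\<gamma> \<in> commutator_group S"
  shows "\<exists>\<gamma>'\<in>commutator_group S. f \<circ> \<gamma> = \<gamma>' \<circ> f"
  using assms push_commutator_group[of f \<gamma>] by auto

lemma commute_insert_id:
  assumes "f \<in> insert id S" "g \<in> insert id S"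
  shows "\<exists>\<gamma>\<in>commutator_group S. f \<circ> g = \<gamma> \<circ> g \<circ> f"
proof (cases "f = id \<or> g = id")
  case True
  then show ?thesis using commutator_group_id by (intro bexI[of _ id]) auto
next
  case False
  then have "f \<in> S" "g \<in> S" using assms by auto
  then show ?thesis using commutatorE[of f g] commutator_set_group by metis
qed

lemma comp_closed_group_translates: "comp_closed group_translates"
  unfolding comp_closed_def
proof (intro ballI)
  fix x y assume "x \<in> group_translates" "y \<in> group_translates"
  then obtain \<gamma> f \<delta> g where x: "x = \<gamma> \<circ> f" "\<gamma> \<in> commutator_group S" "f \<in> insert id S"
    and y: "y = \<delta> \<circ> g" "\<delta> \<in> commutator_group S" "g \<in> insert id S"
    unfolding group_translates_def by blast
  obtain \<delta>' where \<delta>': "\<delta>' \<in> commutator_group S" "f \<circ> \<delta> = \<delta>' \<circ> f"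
    using push_insert_id[OF x(3) y(2)] by blast
  have "x \<circ> y = \<gamma> \<circ> (f \<circ> \<delta>) \<circ> g" by (simp only: x y comp_assoc)
  also have "\<dots> = (\<gamma> \<circ> \<delta>') \<circ> (f \<circ> g)" by (simp only: \<delta>'(2) comp_assoc)
  finally show "x \<circ> y \<in> group_translates"
    using group_translates_I[OF commutator_group_comp[OF x(2) \<delta>'(1)], of "f \<circ> g"] x(3) y(3) comp_mem by auto
qed

lemma right_Folner_group_translates: "right_Folner group_translates"
proof (rule right_Folner_abelian_extension[OF right_Folner_commutator_group])
  show "id \<in> commutator_group S" by (rule commutator_group_id)
  show "commutator_group S \<subseteq> group_translates" using group_translates_I[of _ id] by auto
  show "comp_closed (commutator_group S)"
    using commutator_group_comp by (simp add: comp_closed_def)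
  show "comp_closed group_translates" by (rule comp_closed_group_translates)
next
  fix x y assume "x \<in> group_translates" "y \<in> group_translates"
  then obtain \<gamma> f \<delta> g where x: "x = \<gamma> \<circ> f" "\<gamma> \<in> commutator_group S" "f \<in> insert id S"
    and y: "y = \<delta> \<circ> g" "\<delta> \<in> commutator_group S" "g \<in> insert id S"
    unfolding group_translates_def by blast
  obtain \<delta>' where \<delta>': "\<delta>' \<in> commutator_group S" "f \<circ> \<delta> = \<delta>' \<circ> f"
    using push_insert_id[OF x(3) y(2)] by blast
  obtain \<gamma>' where \<gamma>': "\<gamma>' \<in> commutator_group S" "g \<circ> \<gamma> = \<gamma>' \<circ> g"
    using push_insert_id[OF y(3) x(2)] by blast
  obtain \<kappa> where \<kappa>: "\<kappa> \<in> commutator_group S" "f \<circ> g = \<kappa> \<circ> g \<circ> f"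
    using commute_insert_id[OF x(3) y(3)] by blast
  have \<delta>\<gamma>: "\<delta> \<circ> \<gamma>' \<in> commutator_group S" by (rule commutator_group_comp[OF y(2) \<gamma>'(1)])
  have yx: "y \<circ> x = (\<delta> \<circ> \<gamma>') \<circ> (g \<circ> f)"
  proof -
    have "y \<circ> x = \<delta> \<circ> (g \<circ> \<gamma>) \<circ> f" by (simp only: x y comp_assoc)
    then show ?thesis by (simp only: \<gamma>'(2) comp_assoc)
  qed
  have xy: "x \<circ> y = (\<gamma> \<circ> \<delta>' \<circ> \<kappa>) \<circ> (g \<circ> f)"
  proof -
    have "x \<circ> y = \<gamma> \<circ> (f \<circ> \<delta>) \<circ> g" by (simp only: x y comp_assoc)
    also have "\<dots> = \<gamma> \<circ> \<delta>' \<circ> (f \<circ> g)" by (simp only: \<delta>'(2) comp_assoc)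
    finally show ?thesis by (simp only: \<kappa>(2) comp_assoc)
  qed
  let ?v = "\<gamma> \<circ> \<delta>' \<circ> \<kappa> \<circ> inv\<^bsub>Aff\<^esub> (\<delta> \<circ> \<gamma>')"
  have "?v \<in> commutator_group S"
    by (intro commutator_group_comp commutator_group_inv x y \<delta>' \<gamma>' \<kappa>)
  moreover have "x \<circ> y = ?v \<circ> y \<circ> x"
  proof -
    have "?v \<circ> y \<circ> x = ?v \<circ> (y \<circ> x)" by (simp only: comp_assoc)
    also have "\<dots> = \<gamma> \<circ> \<delta>' \<circ> \<kappa> \<circ> (inv\<^bsub>Aff\<^esub> (\<delta> \<circ> \<gamma>') \<circ> (\<delta> \<circ> \<gamma>')) \<circ> (g \<circ> f)"
      by (simp only: yx comp_assoc)
    also have "\<dots> = x \<circ> y"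
      by (simp only: Aff_inv_comp[OF commutator_group_Aff[OF \<delta>\<gamma>]] comp_id xy)
    finally show ?thesis by simp
  qed
  ultimately show "\<exists>v\<in>commutator_group S. x \<circ> y = v \<circ> y \<circ> x" by blast
qed

text \<open>Common left multiples turn the individual denominators into a common one.\<close>

lemma group_translates_common_denominator:
  assumes Ore: "left_Ore S" and "finite E" "E \<subseteq> group_translates"
  shows "\<exists>s\<in>S. (\<circ>) s ` E \<subseteq> S"
  using assms(2,3)
proof (induction E rule: finite_induct)
  case empty
  then show ?case using S_nonempty by auto
next
  case (insert w E)
  then obtain s where s: "s \<in> S" "(\<circ>) s ` E \<subseteq> S" by blast
  obtain \<gamma> f where w: "w = \<gamma> \<circ> f" "\<gamma> \<in> commutator_group S" "f \<in> insert id S"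
    using insert.prems unfolding group_translates_def by blast
  obtain u where u: "u \<in> S" "u \<circ> \<gamma> \<in> S"
    using commutator_group_left_fraction[OF Ore w(2)] by blast
  have uw: "u \<circ> w \<in> S"
    using w(3) comp_mem[OF u(2), of f] u(2) by (auto simp: w(1) comp_assoc)
  obtain a b where ab: "a \<in> S" "b \<in> S" "a \<circ> s = b \<circ> u"
    using Ore s(1) u(1) unfolding left_Ore_def by meson
  have "(a \<circ> s) \<circ> w \<in> S"
    using comp_mem[OF ab(2) uw] by (simp only: ab(3) comp_assoc)
  moreover have "(a \<circ> s) \<circ> e \<in> S" if "e \<in> E" for e
    using that comp_mem[OF ab(1), of "s \<circ> e"] s(2) by (auto simp: comp_assoc)
  ultimately have "(\<circ>) (a \<circ> s) ` insert w E \<subseteq> S" by blast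
  then show ?case using comp_mem[OF ab(1) s(1)] by blast
qed

lemma right_amenable_if_left_Ore:
  assumes "left_Ore S"
  shows "right_amenable S"
proof (rule right_amenable_if_right_Folner, rule right_Folner_absorbing_subset[OF right_Folner_group_translates])
  show "S \<subseteq> group_translates" using group_translates_I[OF commutator_group_id] by auto
  show "\<exists>s. (\<circ>) s ` E \<subseteq> S" if "finite E" "E \<subseteq> group_translates" for E
    using group_translates_common_denominator[OF assms that] by blast
qed

section \<open>Sources of the left Ore condition\<close>

lemma funpow_Suc_mem: "f \<in> S \<Longrightarrow> f ^^ Suc n \<in> S"
  by (induction n) (use comp_mem in \<open>auto simp: comp_assoc\<close>)

text \<open>Two of the commutators of \<open>f\<close> with the positive powers of \<open>g\<close> coincide, say at exponents \<open>m < n\<close>. Comparing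
  \<open>f \<circ> g ^^ n\<close> with \<open>(f \<circ> g ^^ m) \<circ> g ^^ (n - m)\<close> and removing that commutator gives
  \<open>g ^^ n \<circ> f = g ^^ m \<circ> f \<circ> g ^^ (n - m)\<close>.\<close>

lemma left_Ore_if_finite_commutator_set:
  assumes "finite (commutator_set S)"
  shows "left_Ore S"
  unfolding left_Ore_def
proof (intro ballI)
  fix f g assume f: "f \<in> S" and g: "g \<in> S"
  \<comment> \<open>The commutator with \<open>g ^^ Suc n\<close> has index \<open>n\<close>, as \<open>g ^^ 0\<close> need not belong to \<open>S\<close>.\<close>
  have "\<forall>n. \<exists>\<gamma>. \<gamma> \<in> commutator_set S \<and> f \<circ> g ^^ Suc n = \<gamma> \<circ> g ^^ Suc n \<circ> f"
    using commutatorE[OF f funpow_Suc_mem[OF g]] by metis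
  then obtain c where c: "\<And>n. c n \<in> commutator_set S"
    and comm: "\<And>n. f \<circ> g ^^ Suc n = c n \<circ> g ^^ Suc n \<circ> f"
    by metis
  have "\<not> inj c"
    using finite_imageD[of c UNIV] finite_subset[OF _ assms, of "range c"] c by blast
  then obtain m n where "c m = c n" "m \<noteq> n" by (auto simp: inj_def)
  then have "\<exists>m n. c m = c n \<and> m < n"
    by (metis linorder_neqE_nat)
  then obtain m n where mn: "c m = c n" "m < n" by blast
  then obtain k where k: "n = m + Suc k" using less_imp_Suc_add by auto
  have A: "c m \<in> carrier Aff" using c commutator_set_Aff by blast
  have pow: "g ^^ Suc n = g ^^ Suc m \<circ> g ^^ Suc k"
    by (simp only: k funpow_add[symmetric] add_Suc)
  have "c m \<circ> (g ^^ Suc n \<circ> f) = f \<circ> g ^^ Suc n"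
    by (simp only: comm mn(1) comp_assoc)
  also have "\<dots> = (f \<circ> g ^^ Suc m) \<circ> g ^^ Suc k"
    by (simp only: pow comp_assoc)
  also have "\<dots> = c m \<circ> (g ^^ Suc m \<circ> f \<circ> g ^^ Suc k)"
    by (simp only: comm comp_assoc)
  finally have "inv\<^bsub>Aff\<^esub> (c m) \<circ> (c m \<circ> (g ^^ Suc n \<circ> f)) =
      inv\<^bsub>Aff\<^esub> (c m) \<circ> (c m \<circ> (g ^^ Suc m \<circ> f \<circ> g ^^ Suc k))"
    by (simp only:)
  then have "g ^^ Suc n \<circ> f = g ^^ Suc m \<circ> f \<circ> g ^^ Suc k"
    by (simp only: comp_assoc[symmetric] Aff_inv_comp[OF A] id_comp)
  also have "g ^^ Suc k = g ^^ k \<circ> g" by (rule funpow_Suc_right)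
  finally have eq: "g ^^ Suc n \<circ> f = (g ^^ Suc m \<circ> f \<circ> g ^^ k) \<circ> g"
    by (simp only: comp_assoc)
  have "g ^^ Suc m \<circ> f \<circ> g ^^ k \<in> S"
  proof (cases k)
    case 0
    then show ?thesis using comp_mem[OF funpow_Suc_mem[OF g] f] by simp
  next
    case (Suc j)
    show ?thesis
      unfolding Suc by (intro comp_mem funpow_Suc_mem f g)
  qed
  then show "\<exists>a\<in>S. \<exists>b\<in>S. a \<circ> f = b \<circ> g"
    using eq funpow_Suc_mem[OF g] by blast
qed

lemma foldr_comp_snoc: "foldr (\<circ>) (w @ [x]) id = foldr (\<circ>) w id \<circ> x"
  by (induction w) (simp_all add: comp_assoc)

lemma word_mem:
  assumes "w \<in> lists S"
  shows "foldr (\<circ>) w id \<in> insert id S"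
  using assms
proof (induction w)
  case (Cons f w)
  then have "f \<circ> foldr (\<circ>) w id \<in> S"
    using comp_mem[of f "foldr (\<circ>) w id"] by (metis comp_id insertE)
  moreover have "foldr (\<circ>) (f # w) id = f \<circ> foldr (\<circ>) w id" by simp
  ultimately show ?case by (metis insertI2)
qed simp

text \<open>Strip the longest common suffix from the two words. If one of them is used up, the rest of the
  other equals the identity, which is impossible for a non-injective map. Otherwise the remaining
  words end in different letters.\<close>

lemma common_left_multiple_if_relation:
  assumes noninj: "\<forall>f\<in>S. \<not> inj f" and f: "f \<in> S" and g: "g \<in> S"
    and "w \<in> lists {f, g}" "w' \<in> lists {f, g}" "w \<noteq> w'" "foldr (\<circ>) w id = foldr (\<circ>) w' id"
  shows "\<exists>a\<in>S. \<exists>b\<in>S. a \<circ> f = b \<circ> g"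
proof -
  have lists: "v \<in> lists S" if "v \<in> lists {f, g}" for v
    using that f g by auto
  have ne_id: "foldr (\<circ>) (v @ [x]) id \<noteq> id" if "v \<in> lists {f, g}" "x \<in> {f, g}" for v x
  proof -
    have x: "x \<in> S" using that f g by auto
    have "foldr (\<circ>) (v @ [x]) id = foldr (\<circ>) v id \<circ> x"
      by (rule foldr_comp_snoc)
    also have "\<dots> \<in> S"
      using word_mem[OF lists[OF that(1)]] x comp_mem[of "foldr (\<circ>) v id" x] by auto
    finally show ?thesis using noninj by (metis inj_on_id)
  qed
  show ?thesis
    using assms(4-)
  proof (induction w arbitrary: w' rule: rev_induct)
    case Nil
    then obtain v x where "w' = v @ [x]" by (metis rev_exhaust)
    moreover from this have "v \<in> lists {f, g}" "x \<in> {f, g}" using Nil.prems(2) by auto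
    ultimately show ?case using Nil.prems(4) ne_id[of v x] by (metis foldr.simps(1) id_apply)
  next
    case (snoc x v)
    have v: "v \<in> lists {f, g}" "x \<in> {f, g}" using snoc.prems(1) by auto
    show ?case
    proof (cases w' rule: rev_cases)
      case Nil
      then show ?thesis using snoc.prems(4) ne_id[OF v] by (metis foldr.simps(1) id_apply)
    next
      case w': (snoc v' y)
      have v': "v' \<in> lists {f, g}" "y \<in> {f, g}" using snoc.prems(2) w' by auto
      have eq: "foldr (\<circ>) v id \<circ> x = foldr (\<circ>) v' id \<circ> y"
        using snoc.prems(4) unfolding w' foldr_comp_snoc .
      have mem: "foldr (\<circ>) v id \<in> insert id S" "foldr (\<circ>) v' id \<in> insert id S"
        using word_mem lists v(1) v'(1) by auto
      then have hol: "foldr (\<circ>) v id holomorphic_on UNIV" "foldr (\<circ>) v' id holomorphic_on UNIV"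
        using S_holomorphic holomorphic_on_id by auto
      show ?thesis
      proof (cases "x = y")
        case True
        have "x \<in> S" using v(2) f g by auto
        then have "foldr (\<circ>) v id = foldr (\<circ>) v' id"
          using right_cancel[OF _ _ hol] eq True by blast
        then show ?thesis using snoc.IH[OF v(1) v'(1)] snoc.prems(3) w' True by blast
      next
        case False
        \<comment> \<open>The stripped words may be empty, so a further letter is put in front of them.\<close>
        have a: "f \<circ> foldr (\<circ>) v id \<in> S" "f \<circ> foldr (\<circ>) v' id \<in> S"
          using mem comp_mem[OF f, of "foldr (\<circ>) v id"] comp_mem[OF f, of "foldr (\<circ>) v' id"] f
          by auto
        have "(f \<circ> foldr (\<circ>) v id) \<circ> x = (f \<circ> foldr (\<circ>) v' id) \<circ> y"
          by (simp only: eq comp_assoc)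
        moreover have "x = f \<and> y = g \<or> x = g \<and> y = f" using False v(2) v'(2) by auto
        ultimately show ?thesis using a by metis
      qed
    qed
  qed
qed

lemma left_Ore_if_no_free_subsemigroup:
  assumes noninj: "\<forall>f\<in>S. \<not> inj f" and nofree: "\<not> (\<exists>F\<subseteq>S. free_noncyclic F)"
  shows "left_Ore S"
  unfolding left_Ore_def
proof (intro ballI)
  fix f g assume f: "f \<in> S" and g: "g \<in> S"
  show "\<exists>a\<in>S. \<exists>b\<in>S. a \<circ> f = b \<circ> g"
  proof (cases "f = g")
    case True
    then show ?thesis using f by blast
  next
    case False
    have "comp_closed hull {f, g} \<subseteq> S"
      using f g comp_mem by (intro hull_minimal) (auto simp: comp_closed_def)
    then have "\<not> free_noncyclic (comp_closed hull {f, g})" using nofree by blast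
    then have "\<not> inj_on (\<lambda>w. foldr (\<circ>) w id) {w \<in> lists {f, g}. w \<noteq> []}"
      using False unfolding free_noncyclic_def free_semigroup_on_def by blast
    then obtain w w' where "w \<in> lists {f, g}" "w' \<in> lists {f, g}" "w \<noteq> w'"
      "foldr (\<circ>) w id = foldr (\<circ>) w' id"
      unfolding inj_on_def by blast
    then show ?thesis by (rule common_left_multiple_if_relation[OF noninj f g])
  qed
qed

end

theorem corollary16:
  fixes S :: "(complex \<Rightarrow> complex) set"
  assumes "nearly_abelian S"
    and "\<forall>f\<in>S. \<not> inj f"
    and "finite (commutator_set S) \<or>
         (cancellative (extended_semigroup S) \<and> \<not> (\<exists>F\<subseteq>S. free_noncyclic F))"
  shows "right_amenable S"
proof -
  interpret nearly_abelian_semigroup S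
    by (rule nearly_abelian_semigroup.intro[OF assms(1)])
  have "left_Ore S"
    using left_Ore_if_finite_commutator_set left_Ore_if_no_free_subsemigroup[OF assms(2)] assms(3)
    by blast
  then show ?thesis by (rule right_amenable_if_left_Ore)
qed

end
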